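(* For every integer $L \ge 1$, the reduced tiling polynomial of the cycle graph of length $L$ is $$P_0^L(x_0,x_1) = 2^{-L}\left(\left(x_0 - \sqrt{x_0^2 + 4x_1^2}\right)^L + \left(x_0 + \sqrt{x_0^2+4x_1^2}\right)^L\right).$$
   Context: A partial matching of a graph is a subset of edges (possibly empty) covering each vertex at most once. For the cycle graph of length $L$ (vertices $v_1,\dots,v_L$, edges $v_1v_2,\dots,v_{L-1}v_L,v_Lv_1$), let $T$ be the set of partial matchings, and for $t\in T$ let $s(t)$ be its number of edges. With all tile weights equal to $1$, the (homogenized) tiling polynomial is $P(x_0,x_1,\dots,x_L) = \sum_{t\in T} x_0^{L-2s(t)}\prod_{i:\, v_i \text{ covered by } t} x_i$. The reduced tiling polynomial is obtained by setting $x_1=\cdots=x_L$: $$P_0^L(x_0,x_1) = P\big|_{x_1=\cdots=x_L} = \sum_{t\in T} x_0^{L-2s(t)}x_1^{2s(t)}.$$ Conventions for small $L$: for $L=1$ the only partial matching is the empty one; for $L=2$ the cycle graph has two vertices joined by two parallel edges. *)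

theory Defs
  imports Complex_Main
begin

text \<open>
  A finite multigraph is given by a vertex set, a set of edge names and a map sending each
  edge name to its two endpoints (in an irrelevant order). Parallel edges have different names, and
  a loop covers its vertex twice, so it never belongs to a partial matching.
\<close>

definition cover_count :: "('e \<Rightarrow> 'v \<times> 'v) \<Rightarrow> 'e set \<Rightarrow> 'v \<Rightarrow> nat" where
  "cover_count ends t v = card {e \<in> t. fst (ends e) = v} + card {e \<in> t. snd (ends e) = v}"

definition partial_matchings :: "'v set \<Rightarrow> 'e set \<Rightarrow> ('e \<Rightarrow> 'v \<times> 'v) \<Rightarrow> 'e set set" where
  "partial_matchings V E ends = {t. t \<subseteq> E \<and> (\<forall>v\<in>V. cover_count ends t v \<le> 1)}"

definition covered_vertices :: "'v set \<Rightarrow> ('e \<Rightarrow> 'v \<times> 'v) \<Rightarrow> 'e set \<Rightarrow> 'v set" where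
  "covered_vertices V ends t = {v \<in> V. cover_count ends t v \<ge> 1}"

text \<open>
  The cycle graph of length \<open>L\<close> has vertices and edge names \<open>1, \<dots>, L\<close>. For \<open>L = 1\<close> its only edge
  is a loop, and for \<open>L = 2\<close> it has two parallel edges.
\<close>

definition cycle_ends :: "nat \<Rightarrow> nat \<Rightarrow> nat \<times> nat" where
  "cycle_ends L i = (i, if i = L then 1 else i + 1)"

definition cycle_matchings :: "nat \<Rightarrow> nat set set" where
  "cycle_matchings L = partial_matchings {1..L} {1..L} (cycle_ends L)"

text \<open>
  Polynomials are represented by their evaluation at elements of an arbitrary commutative ring (in
  particular, of a polynomial ring). The natural-number subtraction in the exponent never truncates,
  since a partial matching covers \<open>2 * card t\<close> distinct vertices.
\<close>

definition tiling_poly :: "nat \<Rightarrow> (nat \<Rightarrow> 'a::comm_ring_1) \<Rightarrow> 'a" where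
  "tiling_poly L x = (\<Sum>t\<in>cycle_matchings L.
     x 0 ^ (L - 2 * card t) * (\<Prod>i\<in>covered_vertices {1..L} (cycle_ends L) t. x i))"

definition reduced_tiling_poly :: "nat \<Rightarrow> 'a::comm_ring_1 \<Rightarrow> 'a \<Rightarrow> 'a" where
  "reduced_tiling_poly L x0 x1 = tiling_poly L (\<lambda>i. if i = 0 then x0 else x1)"

end

theory Submission imports Defs begin

text \<open>
  Removing the closing edge \<open>L\<close> splits the matchings of the cycle into the matchings of a path with
  \<open>L\<close> vertices and those of a path with \<open>L - 2\<close> vertices. Path sums satisfy the recurrence
  \<open>S (n + 2) = x0 S (n + 1) + x1\<^sup>2 S n\<close>, whose characteristic roots \<open>a\<close>, \<open>b\<close> have sum \<open>x0\<close> and product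
  \<open>- x1\<^sup>2\<close>; the cycle combination is the power sum \<open>a ^ L + b ^ L\<close>. Working with this power sum
  rather than with a Binet formula for \<open>S\<close> avoids dividing by \<open>a - b\<close>.
\<close>

section \<open>Counting covered vertices\<close>

lemma sum_card_fibres:
  assumes "finite V" "finite t" "f ` t \<subseteq> V"
  shows "(\<Sum>v\<in>V. card {e \<in> t. f e = v}) = card t"
  using sum.group[OF assms(2,1,3), of "\<lambda>_. 1::nat"] by simp

text \<open>In a matching every cover count is 0 or 1, so the covered vertices are counted by the
  sum of the cover counts, to which each edge contributes once per endpoint.\<close>

lemma card_covered_vertices:
  assumes "t \<in> partial_matchings V E ends" "finite V" "finite E" "ends ` E \<subseteq> V \<times> V"
  shows "card (covered_vertices V ends t) = 2 * card t"
proof -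
  have t: "t \<subseteq> E" "\<And>v. v \<in> V \<Longrightarrow> cover_count ends t v \<le> 1"
    using assms(1) by (auto simp: partial_matchings_def)
  have fin: "finite t" using t(1) assms(3) finite_subset by blast
  have im: "(fst \<circ> ends) ` t \<subseteq> V" "(snd \<circ> ends) ` t \<subseteq> V"
    using t(1) assms(4) by (auto simp: image_subset_iff mem_Times_iff)
  have "card (covered_vertices V ends t) = (\<Sum>v\<in>V. if cover_count ends t v \<ge> 1 then 1 else 0)"
    using assms(2) by (simp add: covered_vertices_def sum.If_cases Int_def)
  also have "\<dots> = (\<Sum>v\<in>V. cover_count ends t v)"
    by (intro sum.cong refl) (use t(2) le_antisym in fastforce)
  also have "\<dots> = 2 * card t"
    using sum_card_fibres[OF assms(2) fin im(1)] sum_card_fibres[OF assms(2) fin im(2)]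
    by (simp add: cover_count_def sum.distrib)
  finally show ?thesis .
qed

lemma reduced_tiling_poly_eq_sum:
  "reduced_tiling_poly L x0 x1
     = (\<Sum>t\<in>cycle_matchings L. x0 ^ (L - 2 * card t) * (x1\<^sup>2) ^ card t)"
proof -
  have "(\<Prod>i\<in>covered_vertices {1..L} (cycle_ends L) t. if i = 0 then x0 else x1)
      = (x1\<^sup>2) ^ card t" if "t \<in> cycle_matchings L" for t
  proof -
    have "(\<Prod>i\<in>covered_vertices {1..L} (cycle_ends L) t. if i = 0 then x0 else x1)
        = (\<Prod>i\<in>covered_vertices {1..L} (cycle_ends L) t. x1)"
      \<comment> \<open>Covered vertices lie in \<open>{1..L}\<close>, so the index 0 reserved for
        \<open>x0\<close> never occurs.\<close>
      by (intro prod.cong) (auto simp: covered_vertices_def)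
    moreover have "card (covered_vertices {1..L} (cycle_ends L) t) = 2 * card t"
      using that by (intro card_covered_vertices) (auto simp: cycle_matchings_def cycle_ends_def)
    ultimately show ?thesis by (simp add: power_mult)
  qed
  then show ?thesis
    by (simp add: reduced_tiling_poly_def tiling_poly_def cong: sum.cong)
qed

section \<open>Matchings of the cycle as sets of non-adjacent edges\<close>

text \<open>The edges at \<open>v\<close> are edge \<open>v\<close> and its cyclic predecessor. For
  \<open>L = 1\<close> both are the loop, which is rightly counted twice.\<close>

lemma cover_count_cycle:
  assumes "t \<subseteq> {1..L}" "v \<in> {1..L}"
  shows "cover_count (cycle_ends L) t v
    = of_bool (v \<in> t) + of_bool ((if v = 1 then L else v - 1) \<in> t)"
proof -
  have "{e \<in> t. fst (cycle_ends L e) = v} = (if v \<in> t then {v} else {})"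
    by (auto simp: cycle_ends_def)
  moreover have "{e \<in> t. snd (cycle_ends L e) = v}
      = (if (if v = 1 then L else v - 1) \<in> t then {if v = 1 then L else v - 1} else {})"
    using assms by (auto simp: cycle_ends_def split: if_splits)
  ultimately show ?thesis by (simp add: cover_count_def)
qed

text \<open>The last conjunct is the wrap-around adjacency at vertex 1; for \<open>L = 1\<close> it
  excludes the loop.\<close>

lemma mem_cycle_matchings_iff:
  assumes "L \<ge> 1"
  shows "t \<in> cycle_matchings L
    \<longleftrightarrow> t \<subseteq> {1..L} \<and> (\<forall>i\<in>t. Suc i \<notin> t) \<and> \<not> (1 \<in> t \<and> L \<in> t)"
proof (cases "t \<subseteq> {1..L}")
  case True
  have "t \<in> cycle_matchings L
      \<longleftrightarrow> (\<forall>v\<in>{1..L}. \<not> (v \<in> t \<and> (if v = 1 then L else v - 1) \<in> t))"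
    using True by (auto simp: cycle_matchings_def partial_matchings_def cover_count_cycle)
  also have "\<dots> \<longleftrightarrow> (\<forall>i\<in>t. Suc i \<notin> t) \<and> \<not> (1 \<in> t \<and> L \<in> t)" (is "?A \<longleftrightarrow> ?B")
  proof
    assume A: ?A
    have "Suc i \<notin> t" if "i \<in> t" for i
      using A[rule_format, of "Suc i"] True that by fastforce
    then show ?B using A[rule_format, of 1] assms by auto
  next
    assume B: ?B
    show ?A
    proof
      fix v assume "v \<in> {1..L}"
      then show "\<not> (v \<in> t \<and> (if v = 1 then L else v - 1) \<in> t)"
        using B by (cases v) auto
    qed
  qed
  finally show ?thesis using True by simp
qed (auto simp: cycle_matchings_def partial_matchings_def)

section \<open>Matchings of paths\<close>

text \<open>
  The matchings of a path with \<open>n\<close> edges, hence \<open>n + 1\<close> vertices; edge \<open>i\<close> joins \<open>i\<close> and \<open>i + 1\<close>.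
\<close>

definition path_matchings :: "nat \<Rightarrow> nat \<Rightarrow> nat set set" where
  "path_matchings a n = {t. t \<subseteq> {a..<a + n} \<and> (\<forall>i\<in>t. Suc i \<notin> t)}"

text \<open>The base exponent \<open>Suc n\<close> is the number of vertices, and \<open>y\<close>
  is the weight of an edge, later \<open>x1\<^sup>2\<close>.\<close>

definition path_poly :: "nat \<Rightarrow> nat \<Rightarrow> 'a::comm_ring_1 \<Rightarrow> 'a \<Rightarrow> 'a" where
  "path_poly a n x y = (\<Sum>t\<in>path_matchings a n. x ^ (Suc n - 2 * card t) * y ^ card t)"

lemma finite_path_matchings [simp]: "finite (path_matchings a n)"
  by (rule finite_subset[of _ "Pow {a..<a + n}"]) (auto simp: path_matchings_def)

lemma path_matchings_0 [simp]: "path_matchings a 0 = {{}}"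
  by (auto simp: path_matchings_def)

lemma path_matchings_1: "path_matchings a (Suc 0) = {{}, {a}}"
  by (auto simp: path_matchings_def)

text \<open>Case split on the last edge \<open>Suc (a + n)\<close>: using it forbids edge
  \<open>a + n\<close> and leaves the first \<open>n\<close> edges free.\<close>

lemma path_matchings_Suc_Suc:
  "path_matchings a (Suc (Suc n))
    = path_matchings a (Suc n) \<union> insert (Suc (a + n)) ` path_matchings a n" (is "?A = ?B \<union> ?C")
proof
  show "?A \<subseteq> ?B \<union> ?C"
  proof
    fix t assume t: "t \<in> ?A"
    show "t \<in> ?B \<union> ?C"
    proof (cases "Suc (a + n) \<in> t")
      case True
      have "i \<in> {a..<a + n}" if "i \<in> t - {Suc (a + n)}" for i
      proof -
        have "a \<le> i" "i < Suc (Suc (a + n))" "i \<noteq> a + n"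
          using t that True by (auto simp: path_matchings_def)
        then show ?thesis using that by auto
      qed
      then have "t - {Suc (a + n)} \<in> path_matchings a n"
        using t unfolding path_matchings_def by blast
      then show ?thesis using True by (metis UnI2 image_eqI insert_Diff)
    next
      case False
      then show ?thesis using t by (auto simp: path_matchings_def less_Suc_eq)
    qed
  qed
  show "?B \<union> ?C \<subseteq> ?A" by (fastforce simp: path_matchings_def)
qed

lemma finite_path_matching: "t \<in> path_matchings a n \<Longrightarrow> finite t"
  by (auto simp: path_matchings_def intro: finite_subset)

lemma card_insert_path_matching:
  assumes "t \<in> path_matchings a n" "a + n \<le> m"
  shows "card (insert m t) = Suc (card t)"
proof -
  have "m \<notin> t" using assms by (auto simp: path_matchings_def)
  then show ?thesis using finite_path_matching[OF assms(1)] by simp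
qed

lemma inj_on_insert_path_matchings:
  "a + n \<le> m \<Longrightarrow> inj_on (insert m) (path_matchings a n)"
  by (rule inj_on_inverseI[where g = "\<lambda>t. t - {m}"]) (auto simp: path_matchings_def)

text \<open>Guarantees that the exponent in \<open>path_poly\<close> does not truncate, so that a
  factor \<open>x\<close> can be split off in the recurrence.\<close>

lemma card_path_matching:
  "t \<in> path_matchings a n \<Longrightarrow> 2 * card t \<le> Suc n"
proof (induction n arbitrary: t rule: induct_nat_012)
  case (ge2 n)
  then show ?case
    by (auto simp: path_matchings_Suc_Suc card_insert_path_matching intro: le_SucI)
qed (auto simp: path_matchings_1)

lemma path_poly_0 [simp]: "path_poly a 0 x y = x"
  by (simp add: path_poly_def)

lemma path_poly_1 [simp]: "path_poly a (Suc 0) x y = x\<^sup>2 + y"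
  by (simp add: path_poly_def path_matchings_1 numeral_2_eq_2)

text \<open>The new edge uses up two vertices, which restores the exponent \<open>Suc n\<close>. As
  \<open>m\<close> is any edge beyond the path, this serves both the last edge of a longer path and
  the closing edge of the cycle.\<close>

lemma sum_insert_path_matchings:
  assumes "a + n \<le> m"
  shows "(\<Sum>t\<in>insert m ` path_matchings a n. x ^ (Suc (Suc (Suc n)) - 2 * card t) * y ^ card t)
    = y * path_poly a n x y"
  using assms
  by (simp add: path_poly_def sum.reindex inj_on_insert_path_matchings sum_distrib_left
        card_insert_path_matching algebra_simps cong: sum.cong)

lemma path_poly_Suc_Suc:
  "path_poly a (Suc (Suc n)) x y = x * path_poly a (Suc n) x y + y * path_poly a n x y"
proof -
  have "path_matchings a (Suc n) \<inter> insert (Suc (a + n)) ` path_matchings a n = {}"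
    by (auto simp: path_matchings_def)
  then have "path_poly a (Suc (Suc n)) x y
      = (\<Sum>t\<in>path_matchings a (Suc n). x ^ (Suc (Suc (Suc n)) - 2 * card t) * y ^ card t)
        + y * path_poly a n x y"
    by (subst path_poly_def) (simp add: path_matchings_Suc_Suc sum.union_disjoint
          sum_insert_path_matchings)
  also have "(\<Sum>t\<in>path_matchings a (Suc n). x ^ (Suc (Suc (Suc n)) - 2 * card t) * y ^ card t)
      = x * path_poly a (Suc n) x y"
    unfolding path_poly_def sum_distrib_left
    by (intro sum.cong refl)
      (use card_path_matching[of _ a "Suc n"] in \<open>simp add: Suc_diff_le mult.assoc\<close>)
  finally show ?thesis .
qed

section \<open>From the cycle to paths\<close>

lemma cycle_matchings_1: "cycle_matchings 1 = {{}}"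
  by (auto simp: mem_cycle_matchings_iff subset_singleton_iff)

lemma cycle_matchings_2: "cycle_matchings 2 = {{}, {1}, {2}}"
proof (rule set_eqI)
  fix t :: "nat set"
  have "{1..2::nat} = {1, 2}" by auto
  then have "t \<subseteq> {1..2} \<longleftrightarrow> t \<in> {{}, {1}, {2}, {1, 2}}"
    by (simp only: Pow_iff[symmetric]) (auto simp: Pow_insert)
  then have "t \<in> cycle_matchings 2
      \<longleftrightarrow> t \<in> {{}, {1}, {2}, {1, 2}} \<and> (\<forall>i\<in>t. Suc i \<notin> t) \<and> \<not> (1 \<in> t \<and> 2 \<in> t)"
    by (simp add: mem_cycle_matchings_iff)
  also have "\<dots> \<longleftrightarrow> t \<in> {{}, {1}, {2}}" by auto
  finally show "t \<in> cycle_matchings 2 \<longleftrightarrow> t \<in> {{}, {1}, {2}}" .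
qed

text \<open>Using the closing edge \<open>n + 3\<close> forbids its neighbours \<open>1\<close> and
  \<open>n + 2\<close>, leaving the path of edges 2 to \<open>n + 1\<close>; hence the different
  starting points.\<close>

lemma cycle_matchings_ge3:
  "cycle_matchings (n + 3)
    = path_matchings 1 (Suc (Suc n)) \<union> insert (n + 3) ` path_matchings 2 n" (is "?A = ?B \<union> ?C")
proof
  show "?A \<subseteq> ?B \<union> ?C"
  proof
    fix t assume "t \<in> ?A"
    then have t: "t \<subseteq> {1..n + 3}" "\<forall>i\<in>t. Suc i \<notin> t" "\<not> (1 \<in> t \<and> n + 3 \<in> t)"
      by (simp_all add: mem_cycle_matchings_iff)
    show "t \<in> ?B \<union> ?C"
    proof (cases "n + 3 \<in> t")
      case True
      have "i \<in> {2..<2 + n}" if "i \<in> t - {n + 3}" for i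
      proof -
        have "Suc (n + 2) \<in> t" using True by (simp add: eval_nat_numeral)
        then have "i \<noteq> n + 2" using t(2) that by blast
        moreover have "i \<noteq> 1" "1 \<le> i" "i \<le> n + 3" "i \<noteq> n + 3"
          using t True that by auto
        ultimately show ?thesis by auto
      qed
      then have "t - {n + 3} \<in> path_matchings 2 n"
        using t(2) unfolding path_matchings_def by blast
      then show ?thesis using True by (metis UnI2 image_eqI insert_Diff)
    next
      case False
      have "i \<in> {1..<1 + Suc (Suc n)}" if "i \<in> t" for i
      proof -
        have "i \<noteq> n + 3" "1 \<le> i" "i \<le> n + 3" using t(1) that False by auto
        then show ?thesis by auto
      qed
      then show ?thesis using t(2) unfolding path_matchings_def by blast
    qed
  qed
  show "?B \<union> ?C \<subseteq> ?A"
  proof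
    fix t assume "t \<in> ?B \<union> ?C"
    then consider "t \<in> ?B" | u where "u \<in> path_matchings 2 n" "t = insert (n + 3) u" by blast
    then show "t \<in> ?A"
      by cases (auto simp: mem_cycle_matchings_iff path_matchings_def subset_iff)
  qed
qed

lemma reduced_tiling_poly_ge3:
  "reduced_tiling_poly (n + 3) x0 x1
    = path_poly 1 (Suc (Suc n)) x0 (x1\<^sup>2) + x1\<^sup>2 * path_poly 2 n x0 (x1\<^sup>2)"
proof -
  have "path_matchings 1 (Suc (Suc n)) \<inter> insert (n + 3) ` path_matchings 2 n = {}"
    by (auto simp: path_matchings_def)
  then have "reduced_tiling_poly (n + 3) x0 x1
      = (\<Sum>t\<in>path_matchings 1 (Suc (Suc n)). x0 ^ (n + 3 - 2 * card t) * (x1\<^sup>2) ^ card t)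
        + (\<Sum>t\<in>insert (n + 3) ` path_matchings 2 n. x0 ^ (n + 3 - 2 * card t) * (x1\<^sup>2) ^ card t)"
    unfolding reduced_tiling_poly_eq_sum cycle_matchings_ge3
    by (intro sum.union_disjoint) simp_all
  moreover have "Suc (Suc (Suc n)) = n + 3" by simp
  ultimately show ?thesis
    using sum_insert_path_matchings[of 2 n "n + 3" x0 "x1\<^sup>2"]
    by (simp only: path_poly_def[of 1])
qed

section \<open>Power sums of the characteristic roots\<close>

text \<open>Both sides satisfy the recurrence with coefficients \<open>a + b\<close> and
  \<open>- (a * b)\<close> and agree for \<open>n = 0\<close> and \<open>n = 1\<close>. The offsets
  \<open>k\<close> and \<open>l\<close> do not affect the values.\<close>

lemma path_poly_power_sum:
  fixes a b :: "'a::comm_ring_1"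
  defines "y \<equiv> - (a * b)"
  shows "path_poly k (Suc (Suc n)) (a + b) y + y * path_poly l n (a + b) y
    = a ^ (n + 3) + b ^ (n + 3)"
proof (induction n rule: induct_nat_012)
  case 0
  show ?case by (simp add: path_poly_Suc_Suc y_def algebra_simps eval_nat_numeral)
next
  case 1
  show ?case by (simp add: path_poly_Suc_Suc y_def algebra_simps eval_nat_numeral)
next
  case (ge2 n)
  let ?P = "\<lambda>n. path_poly k (Suc (Suc n)) (a + b) y + y * path_poly l n (a + b) y"
  have "?P (Suc (Suc n)) = (a + b) * ?P (Suc n) + y * ?P n"
    by (simp add: path_poly_Suc_Suc[of k "Suc (Suc n)"] path_poly_Suc_Suc[of l n] algebra_simps)
  also have "\<dots> = a ^ (Suc (Suc n) + 3) + b ^ (Suc (Suc n) + 3)"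
    unfolding ge2.IH by (simp add: y_def algebra_simps eval_nat_numeral)
  finally show ?case .
qed

lemma reduced_tiling_poly_power_sum:
  fixes a b :: "'a::comm_ring_1"
  assumes "L \<ge> 1" "a + b = x0" "a * b = - x1\<^sup>2"
  shows "reduced_tiling_poly L x0 x1 = a ^ L + b ^ L"
proof -
  have y: "x1\<^sup>2 = - (a * b)" using assms(3) by simp
  consider "L = 1" | "L = 2" | n where "L = n + 3"
  proof -
    have "L = 1 \<or> L = 2 \<or> L = (L - 3) + 3" using assms(1) by arith
    then show ?thesis using that by blast
  qed
  then show ?thesis
  proof cases
    case 1
    then show ?thesis
      using assms(2) cycle_matchings_1 by (simp add: reduced_tiling_poly_eq_sum)
  next
    case 2
    have "reduced_tiling_poly 2 x0 x1 = x0\<^sup>2 + 2 * x1\<^sup>2"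
      by (simp add: reduced_tiling_poly_eq_sum cycle_matchings_2)
    then show ?thesis
      unfolding 2 y assms(2)[symmetric] by (simp add: power2_eq_square algebra_simps)
  next
    case 3
    then show ?thesis
      unfolding 3 reduced_tiling_poly_ge3 y assms(2)[symmetric] by (simp only: path_poly_power_sum)
  qed
qed

text \<open>The roots are \<open>(x0 - s) / 2\<close> and \<open>(x0 + s) / 2\<close>, where
  \<open>s\<close> is either square root of the discriminant.\<close>

lemma reduced_tiling_poly_closed_form:
  fixes x0 x1 s :: "'a::field_char_0"
  assumes "L \<ge> 1" "s\<^sup>2 = x0\<^sup>2 + 4 * x1\<^sup>2"
  shows "reduced_tiling_poly L x0 x1 = (1 / 2 ^ L) * ((x0 - s) ^ L + (x0 + s) ^ L)"
proof -
  have "(x0 - s) / 2 * ((x0 + s) / 2) = (x0\<^sup>2 - s\<^sup>2) / 4"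
    by (simp add: power2_eq_square algebra_simps)
  also have "\<dots> = - x1\<^sup>2" using assms(2) by simp
  finally have "(x0 - s) / 2 * ((x0 + s) / 2) = - x1\<^sup>2" .
  moreover have "(x0 - s) / 2 + (x0 + s) / 2 = x0" by (simp flip: add_divide_distrib)
  ultimately have "reduced_tiling_poly L x0 x1 = ((x0 - s) / 2) ^ L + ((x0 + s) / 2) ^ L"
    by (intro reduced_tiling_poly_power_sum assms(1))
  then show ?thesis by (simp only: power_divide add_divide_distrib[symmetric]) simp
qed

text \<open>The second conjunct covers the identity of polynomials: \<open>'a\<close> may be an
  extension of the field of rational functions containing a root of the discriminant.\<close>

theorem proposition3p1:
  fixes L :: nat
  assumes "L \<ge> 1"
  shows "(\<forall>x0 x1 :: real. reduced_tiling_poly L x0 x1 =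
            (1 / 2 ^ L) * ((x0 - sqrt (x0\<^sup>2 + 4 * x1\<^sup>2)) ^ L
                         + (x0 + sqrt (x0\<^sup>2 + 4 * x1\<^sup>2)) ^ L))
       \<and> (\<forall>x0 x1 s :: 'a::field_char_0. s\<^sup>2 = x0\<^sup>2 + 4 * x1\<^sup>2 \<longrightarrow>
            reduced_tiling_poly L x0 x1 = (1 / 2 ^ L) * ((x0 - s) ^ L + (x0 + s) ^ L))"
proof (intro conjI allI impI)
  fix x0 x1 :: real
  show "reduced_tiling_poly L x0 x1 =
            (1 / 2 ^ L) * ((x0 - sqrt (x0\<^sup>2 + 4 * x1\<^sup>2)) ^ L
                         + (x0 + sqrt (x0\<^sup>2 + 4 * x1\<^sup>2)) ^ L)"
    \<comment> \<open>The radicand is nonnegative, so the square of \<open>sqrt\<close> gives it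
      back.\<close>
    by (rule reduced_tiling_poly_closed_form) (use assms in simp_all)
qed (rule reduced_tiling_poly_closed_form[OF assms])

end
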